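(* Let $\Delta t>0$, $n\in\mathbb{N}$ with $n\ge1$, and let $\tilde P_j^n(t)=P_j(m_n(t))$ and $\tilde T_j^n(t)=T_j(m_n(t))$, $j\ge 0$, be the shifted Legendre and Chebyshev-$T$ bases on the block $[(n-1)\Delta t,n\Delta t]$. For Legendre, for $r\ge0$, $$\frac{d^r}{dt^r}\tilde P_j^n(n\Delta t)=\Delta t^{-r}\,\frac{(j+r)!}{r!\,(j-r)!},$$ with the convention that the right-hand side is zero when $j<r$. For Chebyshev-$T$, for $r\ge1$, $$\frac{d^r}{dt^r}\tilde T_j^n(n\Delta t)=\Bigl(\frac{2}{\Delta t}\Bigr)^r\,\frac{j^2\prod_{m=1}^{r-1}(j^2-m^2)}{(2r-1)!!},$$ again with the convention that the right-hand side is zero when $j<r$. In particular, the first-derivative weights are $j(j+1)/\Delta t$ for Legendre and $2j^2/\Delta t$ for Chebyshev-$T$.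
   Context: $P_j$ and $T_j$ are the standard degree-$j$ Legendre polynomial and Chebyshev polynomial of the first kind on $[-1,1]$. $m_n(t)=\frac{2t-(2n-1)\Delta t}{\Delta t}$ is the affine bijection of $[(n-1)\Delta t,n\Delta t]$ onto $[-1,1]$. $(2r-1)!!=(2r-1)(2r-3)\cdots3\cdot1$ is the odd double factorial; an empty product equals $1$. The first-derivative weights are the values of the first time derivatives of the basis functions at $t=n\Delta t$. *)

theory Defs
  imports "HOL-Analysis.Analysis" "HOL-Computational_Algebra.Polynomial"
begin

text \<open>Legendre polynomials by Rodrigues' formula
  \<open>P\<^sub>j = 1 / (2^j j!) * d^j/dx^j (x^2 - 1)^j\<close>.\<close>

definition legendre_P :: "nat \<Rightarrow> real poly" where
  "legendre_P j = smult (1 / (2 ^ j * fact j)) ((pderiv ^^ j) ([:-1, 0, 1:] ^ j))"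

fun chebyshev_T :: "nat \<Rightarrow> real poly" where
  "chebyshev_T 0 = 1"
| "chebyshev_T (Suc 0) = [:0, 1:]"
| "chebyshev_T (Suc (Suc j)) = [:0, 2:] * chebyshev_T (Suc j) - chebyshev_T j"

lemma poly_chebyshev_T_cos: "poly (chebyshev_T j) (cos x) = cos (real j * x)"
proof (induction j rule: chebyshev_T.induct)
  case (3 j)
  have "cos (real j * x + 2 * x) + cos (real j * x) = 2 * cos x * cos (real j * x + x)"
    using cos_add[of "real j * x + x" x] cos_diff[of "real j * x + x" x] by (simp add: algebra_simps)
  with 3 show ?case
    by (simp add: algebra_simps)
qed simp_all

definition block_map :: "real \<Rightarrow> nat \<Rightarrow> real \<Rightarrow> real" where
  "block_map dt n t = (2 * t - (2 * real n - 1) * dt) / dt"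

text \<open>The shifted bases are given on all of \<open>\<real>\<close>, as polynomial functions. So at the right end
  \<open>n * dt\<close> of the block \<open>[(n - 1) * dt, n * dt]\<close> the ordinary derivative exists, and it equals
  the one-sided derivative from within the block.\<close>

definition shifted_P :: "real \<Rightarrow> nat \<Rightarrow> nat \<Rightarrow> real \<Rightarrow> real" where
  "shifted_P dt n j t = poly (legendre_P j) (block_map dt n t)"

definition shifted_T :: "real \<Rightarrow> nat \<Rightarrow> nat \<Rightarrow> real \<Rightarrow> real" where
  "shifted_T dt n j t = poly (chebyshev_T j) (block_map dt n t)"

fun double_fact :: "nat \<Rightarrow> nat" where
  "double_fact 0 = 1"
| "double_fact (Suc 0) = 1"
| "double_fact (Suc (Suc k)) = Suc (Suc k) * double_fact k"

end

theory Submission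
  imports Defs
begin

text \<open>Substituting \<open>x = 1 + y\<close> moves the evaluation point to 0, where the
  \<open>r\<close>-th derivative is \<open>fact r\<close> times the \<open>r\<close>-th coefficient.
  Derivatives at 1 thus become Taylor coefficients.\<close>

lemma poly_higher_pderiv_1:
  fixes p :: "real poly"
  shows "poly ((pderiv ^^ r) p) 1 = fact r * coeff (p \<circ>\<^sub>p [:1, 1:]) r"
proof -
  have "(pderiv ^^ r) (p \<circ>\<^sub>p [:1, 1:]) = (pderiv ^^ r) p \<circ>\<^sub>p [:1, 1:]"
    by (induction r) (simp_all add: pderiv_pcompose pderiv_pCons)
  then have "poly ((pderiv ^^ r) p) 1 = coeff ((pderiv ^^ r) (p \<circ>\<^sub>p [:1, 1:])) 0"
    by (simp add: poly_pcompose flip: poly_0_coeff_0)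
  then show ?thesis
    by (simp add: coeff_higher_pderiv pochhammer_fact)
qed

text \<open>The block map has constant slope \<open>2 / dt\<close>, so the chain rule contributes
  one such factor per derivative. Stating an equality of functions lets the induction differentiate
  once more.\<close>

lemma higher_deriv_poly_block_map:
  assumes "dt \<noteq> 0"
  shows "(deriv ^^ r) (\<lambda>t. poly p (block_map dt n t)) =
    (\<lambda>t. (2 / dt) ^ r * poly ((pderiv ^^ r) p) (block_map dt n t))"
proof (induction r)
  case (Suc r)
  have "((\<lambda>t. (2 / dt) ^ r * poly ((pderiv ^^ r) p) (block_map dt n t)) has_field_derivative
      (2 / dt) ^ Suc r * poly ((pderiv ^^ Suc r) p) (block_map dt n t)) (at t)" for t
    unfolding block_map_def using assms
    by (auto intro!: derivative_eq_intros simp: field_simps)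
  then show ?case
    by (simp add: Suc.IH DERIV_imp_deriv fun_eq_iff del: power_Suc)
qed simp

lemma block_map_right_end: "dt \<noteq> 0 \<Longrightarrow> block_map dt n (real n * dt) = 1"
  by (simp add: block_map_def field_simps)

lemma pcompose_power: "(p ^ k) \<circ>\<^sub>p q = (p \<circ>\<^sub>p q) ^ k"
  for p q :: "'a :: comm_semiring_1 poly"
  by (induction k) (simp_all add: pcompose_mult pcompose_1)

text \<open>With \<open>x = 1 + y\<close> one has \<open>(x\<^sup>2 - 1)^j = y^j (2 + y)^j\<close>, so the \<open>(j + r)\<close>-th derivative at
  \<open>x = 1\<close> is read off the binomial expansion of \<open>(2 + y)^j\<close>.\<close>

lemma higher_pderiv_legendre_P_1:
  "poly ((pderiv ^^ r) (legendre_P j)) 1 =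
    (if j < r then 0 else fact (j + r) / (2 ^ r * fact r * fact (j - r)))"
proof -
  have base: "[:-1, 0, 1:] \<circ>\<^sub>p [:1, 1:] = monom 1 1 * [:2, 1 :: real:]"
    by (simp add: pcompose_pCons monom_altdef)
  then have shift: "([:-1, 0, 1:] ^ j) \<circ>\<^sub>p [:1, 1:] = monom 1 j * [:2, 1 :: real:] ^ j"
    unfolding pcompose_power base power_mult_distrib monom_power by simp
  have "(pderiv ^^ r) (legendre_P j) =
      smult (1 / (2 ^ j * fact j)) ((pderiv ^^ (r + j)) ([:-1, 0, 1:] ^ j))"
    by (simp add: legendre_P_def higher_pderiv_smult funpow_add)
  moreover have "coeff ([:2, 1 :: real:] ^ j) r = real (j choose r) * 2 ^ (j - r)"
    by (cases "r \<le> j")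
      (simp_all add: coeff_linear_poly_power coeff_eq_0 degree_linear_power binomial_eq_0)
  ultimately have "poly ((pderiv ^^ r) (legendre_P j)) 1 =
      fact (r + j) * real (j choose r) * 2 ^ (j - r) / (2 ^ j * fact j)"
    by (simp add: poly_higher_pderiv_1 shift coeff_monom_mult)
  then show ?thesis
    by (auto simp: binomial_fact binomial_eq_0 power_diff field_simps)
qed

text \<open>With \<open>x = cos u\<close>, the left sides are \<open>j * sin u * sin (j * u)\<close>
  and its analogue for \<open>j + 1\<close>; the addition formulas for
  \<open>cos (j * u + u)\<close> and \<open>cos ((j + 1) * u - u)\<close> give the right sides. The
  proof is algebraic: the two identities are carried together through the three-term
  recurrence.\<close>

lemma pderiv_chebyshev_T:
  "[:1, 0, -1:] * pderiv (chebyshev_T j) =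
      smult (real j) ([:0, 1:] * chebyshev_T j - chebyshev_T (Suc j))"
  "[:1, 0, -1:] * pderiv (chebyshev_T (Suc j)) =
      smult (real (Suc j)) (chebyshev_T j - [:0, 1:] * chebyshev_T (Suc j))"
proof (induction j)
  case 0
  show "[:1, 0, -1:] * pderiv (chebyshev_T 0) =
      smult (real 0) ([:0, 1:] * chebyshev_T 0 - chebyshev_T (Suc 0))"
    by simp
  show "[:1, 0, -1:] * pderiv (chebyshev_T (Suc 0)) =
      smult (real (Suc 0)) (chebyshev_T 0 - [:0, 1:] * chebyshev_T (Suc 0))"
    by (simp add: pderiv_pCons one_pCons)
next
  case (Suc j)
  show "[:1, 0, -1:] * pderiv (chebyshev_T (Suc j)) =
      smult (real (Suc j)) ([:0, 1:] * chebyshev_T (Suc j) - chebyshev_T (Suc (Suc j)))"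
    unfolding Suc.IH(2) by (simp add: poly_eq_poly_eq_iff[symmetric] fun_eq_iff)
  show "[:1, 0, -1:] * pderiv (chebyshev_T (Suc (Suc j))) =
      smult (real (Suc (Suc j)))
        (chebyshev_T (Suc j) - [:0, 1:] * chebyshev_T (Suc (Suc j)))"
    unfolding poly_eq_poly_eq_iff[symmetric] fun_eq_iff
  proof
    fix x
    have "(1 - x\<^sup>2) * poly (pderiv (chebyshev_T j)) x =
        real j * (x * poly (chebyshev_T j) x - poly (chebyshev_T (Suc j)) x)"
      "(1 - x\<^sup>2) * poly (pderiv (chebyshev_T (Suc j))) x =
        (1 + real j) * (poly (chebyshev_T j) x - x * poly (chebyshev_T (Suc j)) x)"
      using arg_cong[OF Suc.IH(1), of "\<lambda>p. poly p x"] arg_cong[OF Suc.IH(2), of "\<lambda>p. poly p x"]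
      by (simp_all add: algebra_simps power2_eq_square)
    then show "poly ([:1, 0, -1:] * pderiv (chebyshev_T (Suc (Suc j)))) x =
        poly (smult (real (Suc (Suc j)))
          (chebyshev_T (Suc j) - [:0, 1:] * chebyshev_T (Suc (Suc j)))) x"
      \<comment> \<open>The recurrence is differentiated, multiplied by
        \<open>1 - x\<^sup>2\<close>, and both derivatives are replaced by the induction
        hypotheses.\<close>
      by (simp add: pderiv_mult pderiv_diff pderiv_smult pderiv_pCons) algebra
  qed
qed

text \<open>Differentiating the first identity of \<open>pderiv_chebyshev_T\<close> brings in the
  derivative of \<open>?U\<close>; the two identities themselves then eliminate \<open>?U\<close>
  and that derivative.\<close>

lemma chebyshev_T_ode:
  "[:-1, 0, 1:] * pderiv (pderiv (chebyshev_T j)) + [:0, 1:] * pderiv (chebyshev_T j) =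
    smult ((real j)\<^sup>2) (chebyshev_T j)"
proof -
  let ?T = "chebyshev_T j" and ?U = "chebyshev_T (Suc j)"
  \<comment> \<open>The extra factor makes the elimination division-free; it is a nonzero polynomial
    and is cancelled at the end.\<close>
  have "[:1, 0, -1:] * ([:-1, 0, 1:] * pderiv (pderiv ?T) + [:0, 1:] * pderiv ?T) =
      [:1, 0, -1:] * smult ((real j)\<^sup>2) ?T"
    unfolding poly_eq_poly_eq_iff[symmetric] fun_eq_iff
  proof
    fix x
    have "(1 - x\<^sup>2) * poly (pderiv ?T) x = real j * (x * poly ?T x - poly ?U x)"
      "(1 - x\<^sup>2) * poly (pderiv ?U) x = (1 + real j) * (poly ?T x - x * poly ?U x)"
      using pderiv_chebyshev_T[of j, THEN arg_cong, of "\<lambda>p. poly p x"]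
      by (simp_all add: algebra_simps power2_eq_square)
    moreover have "(1 - x\<^sup>2) * poly (pderiv (pderiv ?T)) x - 2 * x * poly (pderiv ?T) x =
        real j * (poly ?T x + x * poly (pderiv ?T) x - poly (pderiv ?U) x)"
      using pderiv_chebyshev_T(1)[of j, THEN arg_cong, of "\<lambda>p. poly (pderiv p) x"]
      unfolding pderiv_mult pderiv_smult pderiv_diff
      by (simp add: pderiv_pCons algebra_simps power2_eq_square)
    ultimately show "poly ([:1, 0, -1:] *
          ([:-1, 0, 1:] * pderiv (pderiv ?T) + [:0, 1:] * pderiv ?T)) x =
        poly ([:1, 0, -1:] * smult ((real j)\<^sup>2) ?T) x"
      by simp algebra
  qed
  then show ?thesis
    by (subst (asm) mult_cancel_left) simp
qed

text \<open>Comparing coefficients of \<open>y^r\<close> in the differential equation with \<open>x = 1 + y\<close> gives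
  \<open>(r + 1) (2 r + 1) c\<^sub>r\<^sub>+\<^sub>1 = (j\<^sup>2 - r\<^sup>2) c\<^sub>r\<close> for the Taylor coefficients at \<open>x = 1\<close>.\<close>

lemma higher_pderiv_chebyshev_T_1_Suc:
  "(2 * real r + 1) * poly ((pderiv ^^ Suc r) (chebyshev_T j)) 1 =
    ((real j)\<^sup>2 - (real r)\<^sup>2) * poly ((pderiv ^^ r) (chebyshev_T j)) 1"
proof -
  define q where "q = chebyshev_T j \<circ>\<^sub>p [:1, 1:]"
  have q': "pderiv q = pderiv (chebyshev_T j) \<circ>\<^sub>p [:1, 1:]"
    "pderiv (pderiv q) = pderiv (pderiv (chebyshev_T j)) \<circ>\<^sub>p [:1, 1:]"
    by (simp_all add: q_def pderiv_pcompose pderiv_pCons)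
  have "[:0, 2, 1:] * pderiv (pderiv q) + [:1, 1:] * pderiv q = smult ((real j)\<^sup>2) q"
    unfolding q'(2) unfolding q'(1) unfolding q_def poly_eq_poly_eq_iff[symmetric] fun_eq_iff
  proof
    fix y
    show "poly ([:0, 2, 1:] * (pderiv (pderiv (chebyshev_T j)) \<circ>\<^sub>p [:1, 1:]) +
          [:1, 1:] * (pderiv (chebyshev_T j) \<circ>\<^sub>p [:1, 1:])) y =
        poly (smult ((real j)\<^sup>2) (chebyshev_T j \<circ>\<^sub>p [:1, 1:])) y"
      using arg_cong[OF chebyshev_T_ode[of j], of "\<lambda>p. poly p (1 + y)"]
      by (simp add: poly_pcompose algebra_simps)
  qed
  then have "coeff ([:0, 2, 1:] * pderiv (pderiv q) + [:1, 1:] * pderiv q) r =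
      (real j)\<^sup>2 * coeff q r"
    by simp
  then have "(real r + 1) * (2 * real r + 1) * coeff q (Suc r) =
      ((real j)\<^sup>2 - (real r)\<^sup>2) * coeff q r"
    \<comment> \<open>The factor \<open>2 y + y\<^sup>2\<close> shifts indices by one and two, so
      \<open>r = 0\<close> and \<open>r = 1\<close> lack some terms and are treated
      separately.\<close>
    by (cases r; cases "r - 1")
      (auto simp: coeff_pCons coeff_pderiv algebra_simps power2_eq_square split: nat.splits)
  then show ?thesis
    unfolding poly_higher_pderiv_1 q_def[symmetric] by (simp add: mult_ac add_ac)
qed

lemma poly_chebyshev_T_1: "poly (chebyshev_T j) 1 = 1"
  using poly_chebyshev_T_cos[of j 0] by simp

lemma higher_pderiv_chebyshev_T_1:
  "poly ((pderiv ^^ r) (chebyshev_T j)) 1 =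
    (\<Prod>m<r. (real j)\<^sup>2 - (real m)\<^sup>2) / real (double_fact (2 * r - 1))"
proof (induction r)
  case 0
  then show ?case by (simp add: poly_chebyshev_T_1)
next
  case (Suc r)
  \<comment> \<open>At \<open>r = 0\<close> truncated subtraction yields
    \<open>double_fact 0 = 1\<close>, the empty product.\<close>
  have df: "real (double_fact (2 * Suc r - 1)) = (2 * real r + 1) * real (double_fact (2 * r - 1))"
    by (cases r) (simp_all add: algebra_simps)
  have "poly ((pderiv ^^ Suc r) (chebyshev_T j)) 1 =
      ((real j)\<^sup>2 - (real r)\<^sup>2) * poly ((pderiv ^^ r) (chebyshev_T j)) 1 / (2 * real r + 1)"
    using higher_pderiv_chebyshev_T_1_Suc[of r j] by (simp add: eq_divide_eq mult.commute)
  then show ?case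
    unfolding Suc.IH df by (simp add: mult_ac del: funpow.simps)
qed

lemma higher_pderiv_chebyshev_T_1_pos:
  assumes "r \<ge> 1"
  shows "poly ((pderiv ^^ r) (chebyshev_T j)) 1 =
    (if j < r then 0
     else (real j)\<^sup>2 * (\<Prod>m = 1..r - 1. (real j)\<^sup>2 - (real m)\<^sup>2) / real (double_fact (2 * r - 1)))"
proof (cases "j < r")
  case True
  \<comment> \<open>The factor at \<open>m = j\<close> vanishes.\<close>
  then have "(\<Prod>m<r. (real j)\<^sup>2 - (real m)\<^sup>2) = 0"
    by auto
  with True show ?thesis
    by (simp add: higher_pderiv_chebyshev_T_1)
next
  case False
  \<comment> \<open>Splitting off \<open>m = 0\<close> produces the leading
    \<open>j\<^sup>2\<close>.\<close>
  have "{..<r} = insert 0 {1..r - 1}"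
    using assms by auto
  with False show ?thesis
    by (simp add: higher_pderiv_chebyshev_T_1)
qed

theorem corollary3p4:
  fixes dt :: real and n :: nat
  assumes "dt > 0" and "n \<ge> 1"
  shows
    "(\<forall>j r. (deriv ^^ r) (shifted_P dt n j) (real n * dt) =
        (if j < r then 0
         else (1 / dt ^ r) * (fact (j + r) / (fact r * fact (j - r)))))
   \<and> (\<forall>j r. r \<ge> 1 \<longrightarrow> (deriv ^^ r) (shifted_T dt n j) (real n * dt) =
        (if j < r then 0
         else (2 / dt) ^ r * (((real j)\<^sup>2 * (\<Prod>m = 1..r - 1. (real j)\<^sup>2 - (real m)\<^sup>2))
                / real (double_fact (2 * r - 1)))))
   \<and> (\<forall>j. deriv (shifted_P dt n j) (real n * dt) = real j * (real j + 1) / dt)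
   \<and> (\<forall>j. deriv (shifted_T dt n j) (real n * dt) = 2 * (real j)\<^sup>2 / dt)"
proof -
  have P: "(deriv ^^ r) (shifted_P dt n j) (real n * dt) =
      (if j < r then 0 else (1 / dt ^ r) * (fact (j + r) / (fact r * fact (j - r))))" for j r
    \<comment> \<open>The \<open>2 ^ r\<close> in the denominator at 1 cancels against
      \<open>(2 / dt) ^ r\<close>, leaving \<open>1 / dt ^ r\<close>.\<close>
    using assms unfolding shifted_P_def[abs_def]
    by (simp add: higher_deriv_poly_block_map block_map_right_end higher_pderiv_legendre_P_1
        power_divide)
  have T: "(deriv ^^ r) (shifted_T dt n j) (real n * dt) =
      (if j < r then 0
       else (2 / dt) ^ r * (((real j)\<^sup>2 * (\<Prod>m = 1..r - 1. (real j)\<^sup>2 - (real m)\<^sup>2))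
              / real (double_fact (2 * r - 1))))" if "r \<ge> 1" for j r
    using assms that unfolding shifted_T_def[abs_def]
    by (simp add: higher_deriv_poly_block_map block_map_right_end higher_pderiv_chebyshev_T_1_pos)
  have "deriv (shifted_P dt n j) (real n * dt) = real j * (real j + 1) / dt" for j
  proof (cases j)
    case (Suc k)
    \<comment> \<open>With \<open>j = k + 1\<close>, this is the quotient
      \<open>(j + 1)! / (j - 1)! = j (j + 1)\<close>; \<open>j = 0\<close> falls under the zero
      convention.\<close>
    have "fact (Suc k + 1) = (real k + 1) * (real k + 2) * fact k"
      by (simp add: algebra_simps)
    then show ?thesis
      using P[of 1 j] Suc by (simp add: add.commute)
  qed (use P[of 1 j] in simp)
  moreover have "deriv (shifted_T dt n j) (real n * dt) = 2 * (real j)\<^sup>2 / dt" for j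
    using T[of 1 j] by (cases j) simp_all
  ultimately show ?thesis
    using P T by blast
qed

end
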